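(* Let $s>0$ be fixed. Suppose $\mathcal Z(q)$, $\mathcal X(q)$, $\mathcal U(q)$ and $C(q)$ are functions of $q$ ($0<q<1$) satisfying, for all $r>0$, $$\mathcal Z\!\left(e^{-2\pi/\sqrt{rs}}\right)=r\,\mathcal Z\!\left(e^{-2\pi\sqrt{r/s}}\right)C\!\left(e^{-2\pi\sqrt{r/s}}\right),$$ and $$q\frac{d\mathcal X(q)}{dq}=\mathcal U(q)\mathcal X(q)\mathcal Z(q),\qquad \mathcal Z(q)=\sum_{k=0}^\infty\mathcal A_k\mathcal X^k(q),\quad \mathcal A_k\in\mathbb Q.$$ For an integer $N>1$ let $\mathcal M_N(q)=\mathcal Z(q)/\mathcal Z(q^N)$, and set $$\mathbf a_N=\frac{\mathcal U(e^{-2\pi/\sqrt{Ns}})\mathcal X(e^{-2\pi/\sqrt{Ns}})}{2N}\frac{d\mathcal M_N(q)}{d\mathcal X(q)}\bigg|_{q=e^{-2\pi/\sqrt{Ns}}}+\frac{\mathcal U(e^{-2\pi\sqrt{N/s}})\mathcal X(e^{-2\pi\sqrt{N/s}})}{2C(e^{-2\pi\sqrt{N/s}})}\frac{dC(q)}{d\mathcal X(q)}\bigg|_{q=e^{-2\pi\sqrt{N/s}}},$$ $\mathbf b_N=\mathcal U(e^{-2\pi\sqrt{N/s}})$ and $\mathbf X_N=\mathcal X(e^{-2\pi\sqrt{N/s}})$. If the series $\sum_{k\ge0}(\mathbf b_Nk+\mathbf a_N)\mathcal A_k\mathbf X_N^k$ converges, then $$\sqrt{\frac{s}{N}}\,\frac{1}{2\pi}=\sum_{k=0}^\infty(\mathbf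 b_Nk+\mathbf a_N)\mathcal A_k\mathbf X_N^k.$$
   Context: Derivatives with respect to $\mathcal X$ are understood via the chain rule: $\frac{dF(q)}{d\mathcal X(q)}=\left(q\frac{dF}{dq}\right)\big/\left(q\frac{d\mathcal X}{dq}\right)$. *)

theory Defs
  imports "HOL-Analysis.Analysis"
begin

text \<open>
  Functions of \<open>q\<close> with \<open>0 < q < 1\<close> are total functions \<open>real \<Rightarrow> real\<close> whose values outside
  \<open>{0<..<1}\<close> are irrelevant: both nomes below lie in \<open>{0<..<1}\<close> for \<open>r, s > 0\<close>, and
  \<open>deriv\<close> only depends on the values near the point.
\<close>

definition nome :: "real \<Rightarrow> real \<Rightarrow> real" where
  "nome s r = exp (- (2 * pi * sqrt (r / s)))"

definition dual_nome :: "real \<Rightarrow> real \<Rightarrow> real" where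
  "dual_nome s r = exp (- (2 * pi / sqrt (r * s)))"

text \<open>
  The derivative \<open>dF/dX\<close> at \<open>q\<close>, by the chain rule. It is meaningful only where \<open>F\<close> and \<open>X\<close>
  are differentiable and \<open>deriv X q \<noteq> 0\<close>.
\<close>

definition deriv_wrt :: "(real \<Rightarrow> real) \<Rightarrow> (real \<Rightarrow> real) \<Rightarrow> real \<Rightarrow> real" where
  "deriv_wrt X F q = (q * deriv F q) / (q * deriv X q)"

definition multiplier :: "(real \<Rightarrow> real) \<Rightarrow> nat \<Rightarrow> real \<Rightarrow> real" where
  "multiplier Z N q = Z q / Z (q ^ N)"

definition a_coeff ::
  "real \<Rightarrow> (real \<Rightarrow> real) \<Rightarrow> (real \<Rightarrow> real) \<Rightarrow> (real \<Rightarrow> real) \<Rightarrow> (real \<Rightarrow> real) \<Rightarrow> nat \<Rightarrow> real"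
where
  "a_coeff s Z X U C N =
     U (dual_nome s (real N)) * X (dual_nome s (real N)) / (2 * real N)
       * deriv_wrt X (multiplier Z N) (dual_nome s (real N))
     + U (nome s (real N)) * X (nome s (real N)) / (2 * C (nome s (real N)))
       * deriv_wrt X C (nome s (real N))"

definition b_coeff :: "real \<Rightarrow> (real \<Rightarrow> real) \<Rightarrow> nat \<Rightarrow> real" where
  "b_coeff s U N = U (nome s (real N))"

definition X_val :: "real \<Rightarrow> (real \<Rightarrow> real) \<Rightarrow> nat \<Rightarrow> real" where
  "X_val s X N = X (nome s (real N))"

end

theory Submission
  imports Defs
begin

text \<open>
  Write \<open>\<theta> = q d/dq\<close>, \<open>q\<^sub>1\<close> and \<open>q\<^sub>2\<close> for the dual nome and the nome at \<open>r = N\<close>, so that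
  \<open>q\<^sub>2 = q\<^sub>1 ^ N\<close>. Logarithmic differentiation of the transformation formula at \<open>r = N\<close> and of
  \<open>M\<^sub>N(q) = Z(q) / Z(q ^ N)\<close> at \<open>q\<^sub>1\<close> expresses \<open>\<theta>M\<^sub>N(q\<^sub>1)\<close> through \<open>\<theta>Z(q\<^sub>2)\<close> and \<open>\<theta>C(q\<^sub>2)\<close>; in \<open>a\<^sub>N\<close>
  the terms with \<open>\<theta>C\<close> cancel and \<open>a\<^sub>N Z(q\<^sub>2) = sqrt (s / N) / (2 \<pi>) - \<theta>Z(q\<^sub>2) / Z(q\<^sub>2)\<close>. Termwise
  differentiation of the series for \<open>Z\<close> gives \<open>b\<^sub>N \<Sum> k A\<^sub>k X\<^sub>N ^ k = \<theta>Z(q\<^sub>2) / Z(q\<^sub>2)\<close>.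

  Termwise differentiation is legitimate, and \<open>Z\<close> and \<open>C\<close> are differentiable where needed, because
  \<open>X' \<noteq> 0\<close> at \<open>q\<^sub>1\<close> and \<open>q\<^sub>2\<close>: then \<open>X\<close> takes nearby values of larger modulus, where the
  series still converges, so \<open>X(q\<^sub>1)\<close> and \<open>X(q\<^sub>2)\<close> lie inside the disc of convergence.
\<close>

text \<open>Near \<open>x\<close> the function takes values on both sides of \<open>f x\<close>. The
  one lying further from 0 has larger modulus, whatever the sign of \<open>f x\<close>.\<close>

lemma DERIV_nonzero_ex_abs_greater:
  fixes f :: "real \<Rightarrow> real"
  assumes "(f has_real_derivative D) (at x)" "D \<noteq> 0" "\<forall>\<^sub>F y in nhds x. P y"
  shows "\<exists>y. P y \<and> \<bar>f x\<bar> < \<bar>f y\<bar>"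
proof -
  obtain e where e: "e > 0" "\<And>y. dist y x < e \<Longrightarrow> P y"
    using assms(3) unfolding eventually_nhds_metric by blast
  have "\<exists>y. P y \<and> f x < f y \<and> (\<exists>z. P z \<and> f z < f x)"
  proof (cases "D > 0")
    case True
    obtain d1 where d1: "d1 > 0" "\<And>h. 0 < h \<Longrightarrow> h < d1 \<Longrightarrow> f x < f (x + h)"
      using DERIV_pos_inc_right[OF assms(1) True] by blast
    obtain d2 where d2: "d2 > 0" "\<And>h. 0 < h \<Longrightarrow> h < d2 \<Longrightarrow> f (x - h) < f x"
      using DERIV_pos_inc_left[OF assms(1) True] by blast
    define h where "h = min e (min d1 d2) / 2"
    have h: "0 < h" "h < e" "h < d1" "h < d2"
      using e(1) d1(1) d2(1) by (auto simp: h_def min_def)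
    show ?thesis
      using d1(2)[of h] d2(2)[of h] e(2)[of "x + h"] e(2)[of "x - h"] h
      by (auto simp: dist_real_def)
  next
    case False
    then have neg: "D < 0"
      using assms(2) by simp
    obtain d1 where d1: "d1 > 0" "\<And>h. 0 < h \<Longrightarrow> h < d1 \<Longrightarrow> f (x + h) < f x"
      using DERIV_neg_dec_right[OF assms(1) neg] by blast
    obtain d2 where d2: "d2 > 0" "\<And>h. 0 < h \<Longrightarrow> h < d2 \<Longrightarrow> f x < f (x - h)"
      using DERIV_neg_dec_left[OF assms(1) neg] by blast
    define h where "h = min e (min d1 d2) / 2"
    have h: "0 < h" "h < e" "h < d1" "h < d2"
      using e(1) d1(1) d2(1) by (auto simp: h_def min_def)
    show ?thesis
      using d1(2)[of h] d2(2)[of h] e(2)[of "x + h"] e(2)[of "x - h"] h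
      by (auto simp: dist_real_def)
  qed
  then obtain y z where "P y" "f x < f y" "P z" "f z < f x"
    by blast
  then show ?thesis
    by (metis abs_ge_self abs_ge_minus_self abs_if less_le_trans neg_less_iff_less)
qed

text \<open>A nearby \<open>p\<close> with |X p| > |X q| puts \<open>X q\<close> strictly inside the
  disc of convergence, so the chain rule applies. \<open>T\<close> is \<open>X q\<close> times the
  derivative of the power series at \<open>X q\<close>; this form matches the k-weighted series of
  the final formula.\<close>

lemma DERIV_powser_compose:
  fixes X Z :: "real \<Rightarrow> real" and A :: "nat \<Rightarrow> real"
  assumes X: "(X has_real_derivative D) (at q)" "D \<noteq> 0" and nz: "X q \<noteq> 0"
    and Z: "\<forall>\<^sub>F p in nhds q. (\<lambda>k. A k * X p ^ k) sums Z p"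
  obtains T where "(\<lambda>k. real k * A k * X q ^ k) sums T"
    and "(Z has_real_derivative D * T / X q) (at q)"
proof -
  obtain p where p: "(\<lambda>k. A k * X p ^ k) sums Z p" "\<bar>X q\<bar> < \<bar>X p\<bar>"
    using DERIV_nonzero_ex_abs_greater[OF X Z] by blast
  have sm: "summable (\<lambda>k. A k * X p ^ k)"
    using p(1) by (rule sums_summable)
  define S where "S = (\<Sum>k. diffs A k * X q ^ k)"
  have F: "((\<lambda>x. \<Sum>k. A k * x ^ k) has_real_derivative S) (at (X q))"
    unfolding S_def using termdiffs_strong[OF sm] p(2) by simp
  have "((\<lambda>x. \<Sum>k. A k * X x ^ k) has_real_derivative S * D) (at q)"
    using DERIV_chain2[OF F X(1)] .
  moreover have "\<forall>\<^sub>F x in nhds q. (\<Sum>k. A k * X x ^ k) = Z x"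
    using Z by eventually_elim (simp add: sums_iff)
  ultimately have dZ: "(Z has_real_derivative S * D) (at q)"
    using DERIV_cong_ev[OF refl _ refl, THEN iffD1] by fast
  have "summable (\<lambda>k. diffs A k * X q ^ k)"
  proof (rule termdiff_converges)
    show "norm (X q) < \<bar>X p\<bar>"
      using p(2) by simp
    show "summable (\<lambda>k. A k * x ^ k)" if "norm x < \<bar>X p\<bar>" for x
      using powser_inside[OF sm, of x] that by simp
  qed
  then have "(\<lambda>k. real k * A k * X q ^ (k - Suc 0)) sums S"
    using diffs_equiv[of A "X q"] unfolding S_def by simp
  then have "(\<lambda>k. real k * A k * X q ^ (k - Suc 0) * X q) sums (S * X q)"
    by (rule sums_mult2)
  \<comment> \<open>At k = 0 the truncated exponent does no harm: the factor \<open>real k\<close>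
    vanishes.\<close>
  moreover have "real k * A k * X q ^ (k - Suc 0) * X q = real k * A k * X q ^ k" for k
    by (cases k) auto
  ultimately have "(\<lambda>k. real k * A k * X q ^ k) sums (S * X q)"
    by simp
  moreover have "(Z has_real_derivative D * (S * X q) / X q) (at q)"
    using dZ nz by (simp add: mult.commute)
  ultimately show thesis
    by (rule that)
qed

lemma dual_nome_power:
  assumes "s > 0" "N > 0"
  shows "dual_nome s (real N) ^ N = nome s (real N)"
proof -
  have "real N / (sqrt (real N) * sqrt s) = sqrt (real N) / sqrt s"
    using assms real_sqrt_mult_self[of "real N"] by (simp add: field_simps)
  then have "real N * (2 * pi / (sqrt (real N) * sqrt s)) = 2 * pi * (sqrt (real N) / sqrt s)"
    by (metis mult.commute times_divide_eq_left)
  then show ?thesis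
    by (simp add: dual_nome_def nome_def exp_of_nat_mult[symmetric] real_sqrt_mult
        real_sqrt_divide)
qed

theorem theorem2p2:
  fixes s :: real
    and Z X U C :: "real \<Rightarrow> real"
    and A :: "nat \<Rightarrow> real"
    and N :: nat
  assumes "s > 0"
    and "\<And>r. r > 0 \<Longrightarrow> Z (dual_nome s r) = r * Z (nome s r) * C (nome s r)"
    and "\<And>q. 0 < q \<Longrightarrow> q < 1 \<Longrightarrow> X differentiable (at q)"
    and "\<And>q. 0 < q \<Longrightarrow> q < 1 \<Longrightarrow> q * deriv X q = U q * X q * Z q"
    and "\<And>k. A k \<in> \<rat>"
    and "\<And>q. 0 < q \<Longrightarrow> q < 1 \<Longrightarrow> (\<lambda>k. A k * X q ^ k) sums Z q"
    and "N > 1"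
    and "deriv X (dual_nome s (real N)) \<noteq> 0"
    and "deriv X (nome s (real N)) \<noteq> 0"
    and "summable (\<lambda>k. (b_coeff s U N * real k + a_coeff s Z X U C N) * A k * X_val s X N ^ k)"
  shows "sqrt (s / real N) * (1 / (2 * pi)) =
    (\<Sum>k. (b_coeff s U N * real k + a_coeff s Z X U C N) * A k * X_val s X N ^ k)"
proof -
  note s = assms(1) and func = assms(2) and ode = assms(4)
  define q1 where "q1 = dual_nome s (real N)"
  define q2 where "q2 = nome s (real N)"
  have N: "real N > 0"
    using assms(7) by simp
  have q1: "0 < q1" "q1 < 1" and q2: "0 < q2" "q2 < 1"
    using s N by (auto simp: q1_def q2_def dual_nome_def nome_def)
  have q1N: "q1 ^ N = q2"
    using dual_nome_power[OF s, of N] N by (simp add: q1_def q2_def)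
  have dX: "(X has_real_derivative deriv X q) (at q)" if "0 < q" "q < 1" for q
    using assms(3)[OF that] DERIV_deriv_iff_real_differentiable by blast
  \<comment> \<open>The left-hand side of q X' = U X Z is nonzero at both points, hence so is each
    factor on the right.\<close>
  have nz1: "U q1 \<noteq> 0" "X q1 \<noteq> 0" "Z q1 \<noteq> 0" and nz2: "U q2 \<noteq> 0" "X q2 \<noteq> 0" "Z q2 \<noteq> 0"
    using ode[OF q1] ode[OF q2] assms(8,9) q1(1) q2(1) by (auto simp flip: q1_def q2_def)
  have unit_interval: "\<forall>\<^sub>F p in nhds q. 0 < p \<and> p < 1" if "0 < q" "q < 1" for q :: real
    using eventually_nhds_in_open[of "{0<..<1}" q] that by simp
  have Zev: "\<forall>\<^sub>F p in nhds q. (\<lambda>k. A k * X p ^ k) sums Z p" if "0 < q" "q < 1" for q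
    using unit_interval[OF that] by eventually_elim (use assms(6) in auto)
  obtain d1 where d1: "(Z has_real_derivative d1) (at q1)"
    using DERIV_powser_compose[OF dX[OF q1] _ nz1(2) Zev[OF q1]] assms(8) q1_def by blast
  obtain T where T: "(\<lambda>k. real k * A k * X q2 ^ k) sums T"
    and "(Z has_real_derivative deriv X q2 * T / X q2) (at q2)"
    using DERIV_powser_compose[OF dX[OF q2] _ nz2(2) Zev[OF q2]] assms(9) q2_def by blast
  define d2 where "d2 = deriv X q2 * T / X q2"
  have d2: "(Z has_real_derivative d2) (at q2)"
    unfolding d2_def by fact
  have UT: "U q2 * T = q2 * d2 / Z q2"
    using ode[OF q2] nz2 by (simp add: d2_def field_simps)

  \<comment> \<open>\<rho> inverts the nome as a function of r, and \<sigma> sends a nome to its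
    dual. The transformation formula thus becomes an identity in q that can be differentiated at
    \<open>q2\<close>.\<close>
  define \<rho> where "\<rho> q = s * (ln q / (2 * pi))\<^sup>2" for q
  define \<sigma> where "\<sigma> q = exp (4 * pi\<^sup>2 / (s * ln q))" for q
  have \<rho>_nome: "\<rho> q > 0" "nome s (\<rho> q) = q" "dual_nome s (\<rho> q) = \<sigma> q" if "0 < q" "q < 1" for q
  proof -
    have l: "ln q < 0"
      using that by simp
    show "\<rho> q > 0"
      using l s by (simp add: \<rho>_def)
    \<comment> \<open>The minus sign appears because ln q < 0.\<close>
    have "sqrt (\<rho> q / s) = - ln q / (2 * pi)"
      using s l by (simp add: \<rho>_def real_sqrt_abs)
    then show "nome s (\<rho> q) = q"
      using that by (simp add: nome_def)
    have "\<rho> q * s = (s * ln q / (2 * pi))\<^sup>2"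
      by (simp add: \<rho>_def power2_eq_square)
    then have "sqrt (\<rho> q * s) = - (s * ln q) / (2 * pi)"
      using s l by (simp add: real_sqrt_abs abs_mult)
    then show "dual_nome s (\<rho> q) = \<sigma> q"
      by (simp add: dual_nome_def \<sigma>_def power2_eq_square)
  qed
  have funcq: "Z (\<sigma> q) = \<rho> q * Z q * C q" if "0 < q" "q < 1" for q
    using func[OF \<rho>_nome(1)[OF that]] \<rho>_nome[OF that] by simp
  define v where "v = sqrt (real N / s)"
  have v: "v > 0" "v\<^sup>2 = real N / s"
    using s N by (auto simp: v_def)
  have lnq2: "ln q2 = - (2 * pi * v)"
    by (simp add: q2_def nome_def v_def)
  have \<rho>2: "\<rho> q2 = real N"
    using v s by (simp add: \<rho>_def lnq2)
  have \<sigma>2: "\<sigma> q2 = q1"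
    using \<rho>_nome(3)[OF q2] by (simp add: \<rho>2 q1_def)
  have Z1: "Z q1 = real N * Z q2 * C q2"
    using funcq[OF q2] by (simp add: \<rho>2 \<sigma>2)
  then have Cnz: "C q2 \<noteq> 0"
    using nz1 by auto

  have dr: "(\<rho> has_real_derivative - (s * v / (pi * q2))) (at q2)"
    unfolding \<rho>_def using q2 lnq2
    by (auto intro!: derivative_eq_intros simp: field_simps power2_eq_square)
  \<comment> \<open>The constant comes from (ln q2)^2 = 4 pi^2 N / s.\<close>
  have ds: "(\<sigma> has_real_derivative - (q1 / (real N * q2))) (at q2)"
  proof -
    have "(\<sigma> has_real_derivative \<sigma> q2 * (- (4 * pi\<^sup>2 * (s / q2)) / (s * ln q2)\<^sup>2)) (at q2)"
      unfolding \<sigma>_def using q2 s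
      by (auto intro!: derivative_eq_intros simp: power2_eq_square)
    moreover have "(s * ln q2)\<^sup>2 = 4 * pi\<^sup>2 * s * real N"
      using s by (simp add: lnq2 power_mult_distrib v(2)) (simp add: power2_eq_square)
    ultimately show ?thesis
      using s by (simp add: \<sigma>2 mult.commute)
  qed
  have dZs: "((\<lambda>q. Z (\<sigma> q)) has_real_derivative d1 * (- (q1 / (real N * q2)))) (at q2)"
    using DERIV_chain2[OF _ ds] d1 \<sigma>2 by simp
  \<comment> \<open>Differentiability of \<open>C\<close> at \<open>q2\<close> is derived: near
    \<open>q2\<close>, \<open>C\<close> is a quotient of differentiable functions with nonzero
    denominator.\<close>
  have "\<forall>\<^sub>F q in nhds q2. Z q \<noteq> 0"
    using DERIV_isCont[OF d2] nz2(3)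
    by (simp add: continuous_at eventually_nhds_conv_at tendsto_imp_eventually_ne)
  with unit_interval[OF q2]
  have Cev: "\<forall>\<^sub>F q in nhds q2. Z (\<sigma> q) / (\<rho> q * Z q) = C q"
  proof eventually_elim
    case (elim q)
    then show ?case
      using funcq[of q] \<rho>_nome(1)[of q] by simp
  qed
  have "\<exists>c. ((\<lambda>q. Z (\<sigma> q) / (\<rho> q * Z q)) has_real_derivative c) (at q2)"
    using DERIV_divide[OF dZs DERIV_mult[OF dr d2]] \<rho>2 N nz2 by auto
  then obtain c where c: "(C has_real_derivative c) (at q2)"
    using DERIV_cong_ev[OF refl Cev refl] by blast
  have "((\<lambda>q. \<rho> q * Z q * C q) has_real_derivative
      (- (s * v / (pi * q2)) * Z q2 + d2 * real N) * C q2 + c * (real N * Z q2)) (at q2)"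
    using DERIV_mult[OF DERIV_mult[OF dr d2] c] by (simp add: \<rho>2)
  moreover have "\<forall>\<^sub>F q in nhds q2. \<rho> q * Z q * C q = Z (\<sigma> q)"
    using unit_interval[OF q2] by eventually_elim (use funcq in auto)
  ultimately have "((\<lambda>q. Z (\<sigma> q)) has_real_derivative
      (- (s * v / (pi * q2)) * Z q2 + d2 * real N) * C q2 + c * (real N * Z q2)) (at q2)"
    using DERIV_cong_ev[OF refl _ refl, THEN iffD1] by fast
  \<comment> \<open>Equate the two derivatives of Z(\<sigma> q) at \<open>q2\<close>, one by the
    chain rule and one by the product rule, and multiply by -q2.\<close>
  from DERIV_unique[OF dZs this] have "d1 * q1 / real N =
      (s * v / pi * Z q2 - q2 * d2 * real N) * C q2 - q2 * c * (real N * Z q2)"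
    using q2 N by (simp add: field_simps)
  then have d1_eq: "q1 * d1 = real N *
      ((s * v / pi * Z q2 - q2 * d2 * real N) * C q2 - q2 * c * (real N * Z q2))"
    using N by (simp add: field_simps)

  have "(Z has_real_derivative d2) (at (q1 ^ N))"
    using d2 by (simp add: q1N)
  from DERIV_chain2[OF this DERIV_power[OF DERIV_ident]]
  have dZN: "((\<lambda>q. Z (q ^ N)) has_real_derivative d2 * (real N * q1 ^ (N - Suc 0))) (at q1)"
    by simp
  have "(multiplier Z N has_real_derivative
      (d1 * Z q2 - Z q1 * (d2 * (real N * q1 ^ (N - Suc 0)))) / (Z q2 * Z q2)) (at q1)"
    using DERIV_divide[OF d1 dZN] nz2(3) by (simp add: q1N multiplier_def[abs_def])
  then have "deriv (multiplier Z N) q1 =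
      (d1 * Z q2 - Z q1 * (d2 * (real N * q1 ^ (N - Suc 0)))) / (Z q2 * Z q2)"
    by (rule DERIV_imp_deriv)
  moreover have "q1 * q1 ^ (N - Suc 0) = q2"
    using q1N N by (cases N) auto
  ultimately have dM: "q1 * deriv (multiplier Z N) q1 =
      (q1 * d1 * Z q2 - Z q1 * d2 * real N * q2) / (Z q2 * Z q2)"
    by (simp add: algebra_simps)

  define a where "a = a_coeff s Z X U C N"
  \<comment> \<open>The differential equation turns each q X' in a denominator into U X Z, whose
    factor U X then cancels.\<close>
  have "a = U q1 * X q1 / (2 * real N) * (q1 * deriv (multiplier Z N) q1 / (U q1 * X q1 * Z q1))
      + U q2 * X q2 / (2 * C q2) * (q2 * c / (U q2 * X q2 * Z q2))"
    using ode[OF q1] ode[OF q2] DERIV_imp_deriv[OF c]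
    by (simp add: a_def a_coeff_def deriv_wrt_def flip: q1_def q2_def)
  also have "\<dots> = q1 * deriv (multiplier Z N) q1 / (2 * real N * Z q1) + q2 * c / (2 * C q2 * Z q2)"
    using nz1 nz2 by simp
  \<comment> \<open>The \<open>c\<close> terms cancel. One half of q2 d2 / Z(q2)^2 comes from
    \<open>d1_eq\<close>, the other from differentiating Z(q^N) in the multiplier.\<close>
  also have "\<dots> = s * v / (2 * pi * real N * Z q2) - q2 * d2 / (Z q2)\<^sup>2"
    unfolding dM d1_eq Z1 using nz2(3) Cnz N
    by (simp add: field_simps power2_eq_square)
  finally have aZ: "a * Z q2 = s * v / (2 * pi * real N) - q2 * d2 / Z q2"
    using nz2(3) by (simp add: field_simps power2_eq_square)
  \<comment> \<open>By \<open>UT\<close> and \<open>aZ\<close> the terms q2 d2 / Z(q2) cancel in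
    this sum, leaving only the constant.\<close>
  have "(\<lambda>k. U q2 * (real k * A k * X q2 ^ k) + a * (A k * X q2 ^ k)) sums (U q2 * T + a * Z q2)"
    by (intro sums_add sums_mult T assms(6) q2)
  then have "(\<lambda>k. (b_coeff s U N * real k + a) * A k * X_val s X N ^ k) sums
      (s * v / (2 * pi * real N))"
    by (simp only: UT aZ) (simp add: b_coeff_def X_val_def algebra_simps flip: q2_def)
  moreover have "s * v / real N = sqrt (s / real N)"
  proof -
    have "sqrt (s / real N) = inverse v"
      by (simp add: v_def real_sqrt_divide)
    also have "\<dots> = v / v\<^sup>2"
      using v(1) by (simp add: power2_eq_square field_simps)
    finally show ?thesis
      using s N by (simp add: v(2) field_simps)
  qed
  ultimately show ?thesis
    unfolding a_def by (simp add: sums_iff field_simps)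
qed

end
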